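(* For $\beta\ge0$ let $$\mathcal C(\beta)=\mu\,\Pi_\infty(\beta)+\nu\,\mathcal V(\beta)+\tilde\Lambda\,\beta,\qquad \Pi_\infty(\beta)=\frac{a+\sqrt{a^2+\beta s}}{\beta},\qquad \mathcal V(\beta)=\Pi_\infty(\beta)^2\beta,$$ with $a=-\bar a$, $\bar a>0$, and $\Pi_\infty(0)=s/(2\bar a)$, and let $\pi_0=\dfrac{s^2}{8\bar a^3}$, $v_0=\dfrac{s^2}{4\bar a^2}$. The optimum $\beta^\star$ is the minimiser of $\mathcal C$ over $\beta\ge0$. (i) If $\mu\pi_0>\nu v_0+\tilde\Lambda$, equivalently $\mu>2\bar a\,\nu+\dfrac{8\bar a^3}{s^2}\tilde\Lambda$, then $\mathcal C'(0)<0$ while $\mathcal C(\beta)\to+\infty$ as $\beta\to\infty$, so the optimum $\beta^\star\in(0,\infty)$ is interior and solves $\mu\Pi_\infty'(\beta^\star)+\nu\mathcal V'(\beta^\star)+\tilde\Lambda=0$. (ii) If $\mu\pi_0\le\nu v_0+\tilde\Lambda$, then $\mathcal C'(0)\ge0$ and the optimum is the corner $\beta^\star=0$. (iii) The interior optimum is decreasing in congestion sensitivity: $\partial\beta^\star/\partial\nu<0$. As the network approaches the gridlock-cascade threshold ($\rho(\mathbf\Gamma^{-1}H)\uparrow1$, hence $\nu\uparrow\infty$), $\beta^\star\downarrow0$.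
   Context: Scalar symmetric special case ($n=m=1$, identical zones, constant coefficients). $s=\sigma^2+\lambda\Sigma_J>0$ is the total predicted state variance rate ($\sigma$ the storm volatility, $\lambda$ the jump intensity, $\Sigma_J$ the jump variance). $\beta=\alpha^2/r\ge0$ is the disclosure intensity ($\alpha$ the disclosure gain, $r>0$ the observation noise variance). $\Pi_\infty(\beta)$ is the stabilising root of the scalar Riccati equation $2a\Pi+s-\beta\Pi^2=0$, and satisfies $\Pi_\infty(\beta)=\frac{s}{2\bar a}-\pi_0\beta+O(\beta^2)$; $\mathcal V(\beta)=v_0\beta+O(\beta^2)$. $\mathcal C(\beta)$ is the steady-state per-unit-time social cost: $\mu>0$ scales the mis-evacuation cost in belief variance, $\nu>0$ scales the convex congestion response to synchronised egress (congestion sensitivity), and $\tilde\Lambda=r\Lambda>0$ prices disclosure. In (iii), $\mathbf\Gamma=\operatorname{diag}(c_1'',\dots,c_N'')$ collects the curvatures of the zones' mobilisation costs, $H=\Phi^\top\operatorname{diag}(\eta_\ell\mathbf 1\{q_\ell>\kappa_\ell\})\Phi$ is the congestion coupling matrix (routing matrix $\Phi$, gridlock penalties $\eta_\ell$, corridor loads $q_\ell$, capacities $\kappa_\ell$), and $\rho(\cdot)$ is the spectral radius; in the model $\nu$ blows up as $\rho(\mathbf\Gamma^{-1}H)\uparrow1$. *)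

theory Defs
  imports "HOL-Analysis.Derivative" "Jordan_Normal_Form.Spectral_Radius"
begin

(* Steady-state belief variance: the stabilising root of 2*a*P + s - beta*P^2 = 0 with
   a = -abar < 0; at beta = 0 the equation is linear, with root s/(2*abar). *)
definition Pi_inf :: "real \<Rightarrow> real \<Rightarrow> real \<Rightarrow> real" where
  "Pi_inf s abar \<beta> =
     (if \<beta> = 0 then s / (2 * abar) else (- abar + sqrt ((- abar)\<^sup>2 + \<beta> * s)) / \<beta>)"

definition V_inf :: "real \<Rightarrow> real \<Rightarrow> real \<Rightarrow> real" where
  "V_inf s abar \<beta> = (Pi_inf s abar \<beta>)\<^sup>2 * \<beta>"

definition pi0 :: "real \<Rightarrow> real \<Rightarrow> real" where
  "pi0 s abar = s\<^sup>2 / (8 * abar ^ 3)"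

definition v0 :: "real \<Rightarrow> real \<Rightarrow> real" where
  "v0 s abar = s\<^sup>2 / (4 * abar\<^sup>2)"

definition social_cost :: "real \<Rightarrow> real \<Rightarrow> real \<Rightarrow> real \<Rightarrow> real \<Rightarrow> real \<Rightarrow> real" where
  "social_cost s abar \<mu> L \<nu> \<beta> = \<mu> * Pi_inf s abar \<beta> + \<nu> * V_inf s abar \<beta> + L * \<beta>"

(* The Hilbert choice in arg_min is harmless only once the minimiser is known to exist and
   to be unique. *)
definition opt_disclosure :: "real \<Rightarrow> real \<Rightarrow> real \<Rightarrow> real \<Rightarrow> real \<Rightarrow> real" where
  "opt_disclosure s abar \<mu> L \<nu> = (ARG_MIN (social_cost s abar \<mu> L \<nu>) \<beta>. 0 \<le> \<beta>)"

(* State of an evacuation network; zones are 0..<zones, corridors are 0..<corridors.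
   mob_level is the argument at which the mobilisation costs are evaluated. *)
record evac_network =
  zones :: nat
  corridors :: nat
  mob_cost :: "nat \<Rightarrow> real \<Rightarrow> real"
  mob_level :: "nat \<Rightarrow> real"
  routing :: "real mat"
  penalty :: "nat \<Rightarrow> real"
  load :: "nat \<Rightarrow> real"
  capacity :: "nat \<Rightarrow> real"

definition curvature :: "evac_network \<Rightarrow> nat \<Rightarrow> real" where
  "curvature w i = deriv (deriv (mob_cost w i)) (mob_level w i)"

definition wf_network :: "evac_network \<Rightarrow> bool" where
  "wf_network w \<longleftrightarrow>
     0 < zones w \<and>
     routing w \<in> carrier_mat (corridors w) (zones w) \<and>
     (\<forall>l < corridors w. 0 \<le> penalty w l) \<and>
     (\<forall>i < zones w.
        (\<forall>\<^sub>F x in nhds (mob_level w i). mob_cost w i differentiable at x) \<and>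
        deriv (mob_cost w i) differentiable at (mob_level w i) \<and>
        0 < curvature w i)"

definition Gamma_mat :: "evac_network \<Rightarrow> real mat" where
  "Gamma_mat w = mat_diag (zones w) (curvature w)"

definition coupling_mat :: "evac_network \<Rightarrow> real mat" where
  "coupling_mat w =
     transpose_mat (routing w) *
     mat_diag (corridors w) (\<lambda>l. penalty w l * of_bool (load w l > capacity w l)) *
     routing w"

(* On well-formed networks Gamma_mat is an invertible diagonal matrix, so mat_inverse is a
   Some; the product is cast to the complex numbers to take its spectral radius. *)
definition cascade_radius :: "evac_network \<Rightarrow> real" where
  "cascade_radius w =
     spectral_radius (map_mat complex_of_real (the (mat_inverse (Gamma_mat w)) * coupling_mat w))"

end

theory Submission
  imports Defs
begin

text \<open>
The Riccati equation, read as \<open>\<beta> * \<Pi>\<^sup>2 = s - 2 * abar * \<Pi>\<close>, says that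
\<open>\<V>\<close> is an affine function of the belief variance. Hence
\<open>\<C>(\<beta>) = (\<mu> - 2 * abar * \<nu>) * \<Pi>(\<beta>) + \<nu> * s + L * \<beta>\<close>: congestion merely lowers the
price put on variance. In terms of the closed-loop rate \<open>r = sqrt (abar\<^sup>2 + \<beta> * s)\<close>, which
ranges over \<open>r \<ge> abar\<close> when \<open>\<beta> \<ge> 0\<close>, one has \<open>\<Pi> = s / (abar + r)\<close> and
\<open>\<beta> = (r\<^sup>2 - abar\<^sup>2) / s\<close>, so that up to a positive factor and an additive constant the cost
is \<open>k / (abar + r) + r\<^sup>2\<close> with the single parameter
\<open>k = (\<mu> - 2 * abar * \<nu>) * s\<^sup>2 / L\<close>.

The stationary points of this function solve the cubic equation \<open>2 * r * (abar + r)\<^sup>2 = k\<close>,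
whose left side increases strictly on \<open>r \<ge> 0\<close> and equals \<open>8 * abar ^ 3\<close> at
\<open>r = abar\<close>. The interior case is therefore \<open>k > 8 * abar ^ 3\<close>, which is what both forms of the
condition in the theorem say (\<open>interior_condition_iff\<close>). Otherwise the minimum sits at the corner
\<open>r = abar\<close>. Both cases are covered by solving the cubic equation for \<open>max k (8 * abar ^ 3)\<close>,
and a factorisation of the cost difference shows that the solution is the unique minimiser
(\<open>rate_cost_less\<close>, \<open>social_cost_minimiser\<close>).

Since \<open>k\<close> is affine and decreasing in \<open>\<nu>\<close>, the comparative statics come from the inverse of the
cubic: it is increasing, with positive derivative. For \<open>\<nu> \<ge> \<mu> / (2 * abar)\<close> one has
\<open>k \<le> 0\<close>, so the optimum is not just small but exactly \<open>0\<close>; the limit at the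
cascade threshold is then the composition of this with the divergence of the sensitivity.
\<close>

section \<open>Belief variance in terms of the closed-loop rate\<close>

text \<open>
This is \<open>abar + \<beta> * \<Pi>\<close>, the decay rate of the filtering error.
\<close>

definition closed_loop_rate :: "real \<Rightarrow> real \<Rightarrow> real \<Rightarrow> real" where
  "closed_loop_rate s abar \<beta> = sqrt (abar\<^sup>2 + \<beta> * s)"

text \<open>Rationalising the numerator removes the singularity at \<open>\<beta> = 0\<close>, so that one formula, smooth
near \<open>0\<close> on both sides, replaces the case distinction in the definition.\<close>

lemma Pi_inf_eq:
  assumes "abar > 0" "0 \<le> abar\<^sup>2 + \<beta> * s"
  shows "Pi_inf s abar \<beta> = s / (abar + closed_loop_rate s abar \<beta>)"
proof (cases "\<beta> = 0")
  case True
  then show ?thesis using assms by (simp add: Pi_inf_def closed_loop_rate_def)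
next
  case False
  define r where "r = closed_loop_rate s abar \<beta>"
  have r: "r \<ge> 0" "r\<^sup>2 = abar\<^sup>2 + \<beta> * s"
    using assms by (auto simp: r_def closed_loop_rate_def)
  have "(r - abar) * (abar + r) = s * \<beta>"
    using r(2) by (simp add: algebra_simps power2_eq_square)
  moreover have "abar + r \<noteq> 0" using assms r by simp
  ultimately have "(r - abar) / \<beta> = s / (abar + r)"
    using False by (simp add: frac_eq_eq)
  then show ?thesis
    using False by (simp add: Pi_inf_def r_def closed_loop_rate_def)
qed

text \<open>This is the Riccati equation.\<close>

lemma V_inf_eq:
  assumes "abar > 0" "0 \<le> abar\<^sup>2 + \<beta> * s"
  shows "V_inf s abar \<beta> = s - 2 * abar * Pi_inf s abar \<beta>"
proof -
  define r where "r = closed_loop_rate s abar \<beta>"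
  have r: "r \<ge> 0" "r\<^sup>2 = abar\<^sup>2 + \<beta> * s"
    using assms by (auto simp: r_def closed_loop_rate_def)
  have Pi: "Pi_inf s abar \<beta> = s / (abar + r)"
    using Pi_inf_eq[OF assms] by (simp add: r_def)
  have ne: "abar + r \<noteq> 0" using assms r by simp
  have "s\<^sup>2 * \<beta> = s * ((r - abar) * (abar + r))"
    using r(2) by (simp add: algebra_simps power2_eq_square)
  then have "V_inf s abar \<beta> = s * (r - abar) / (abar + r)"
    using ne unfolding V_inf_def Pi
    by (simp add: power_divide frac_eq_eq power2_eq_square)
  also have "\<dots> = s - 2 * abar * (s / (abar + r))"
    using ne by (simp add: field_simps)
  finally show ?thesis by (simp add: Pi)
qed

lemma social_cost_eq:
  assumes "abar > 0" "0 \<le> abar\<^sup>2 + \<beta> * s"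
  shows "social_cost s abar \<mu> L \<nu> \<beta> =
    (\<mu> - 2 * abar * \<nu>) * Pi_inf s abar \<beta> + \<nu> * s + L * \<beta>"
  unfolding social_cost_def V_inf_eq[OF assms] by (simp add: algebra_simps)

text \<open>The closed forms are valid only where the radicand is nonnegative, so they can be differentiated
only after checking that this persists near the point. At \<open>\<beta> = 0\<close> this includes negative
arguments, which makes the derivative there two-sided.\<close>

lemma eventually_rate_radicand_pos:
  assumes "0 < abar\<^sup>2 + \<beta> * s"
  shows "eventually (\<lambda>b. 0 < abar\<^sup>2 + b * s) (nhds (\<beta>::real))"
proof -
  have "open {b. 0 < abar\<^sup>2 + b * s}"
    by (intro open_Collect_less continuous_intros)
  then show ?thesis using assms eventually_nhds_in_open by fastforce
qed

lemma DERIV_Pi_inf: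
  assumes "abar > 0" "0 < abar\<^sup>2 + \<beta> * s"
  defines "r \<equiv> closed_loop_rate s abar \<beta>"
  shows "(Pi_inf s abar has_real_derivative - s\<^sup>2 / (2 * r * (abar + r)\<^sup>2)) (at \<beta>)"
proof -
  have r: "r > 0" using assms by (simp add: r_def closed_loop_rate_def)
  have "(closed_loop_rate s abar has_real_derivative s / (2 * r)) (at \<beta>)"
    using assms(2) unfolding closed_loop_rate_def[abs_def] r_def
    by (auto intro!: derivative_eq_intros simp: field_simps)
  then have "((\<lambda>b. s / (abar + closed_loop_rate s abar b)) has_real_derivative
          - (s * (s / (2 * r))) / ((abar + r) * (abar + r))) (at \<beta>)"
    using assms(1) r by (auto intro!: derivative_eq_intros simp: r_def)
  then have "((\<lambda>b. s / (abar + closed_loop_rate s abar b)) has_real_derivative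
          - s\<^sup>2 / (2 * r * (abar + r)\<^sup>2)) (at \<beta>)"
    by (simp add: power2_eq_square mult.assoc)
  moreover have "\<forall>\<^sub>F b in nhds \<beta>. s / (abar + closed_loop_rate s abar b) = Pi_inf s abar b"
    using eventually_rate_radicand_pos[OF assms(2)]
    by eventually_elim (simp add: Pi_inf_eq assms(1))
  ultimately show ?thesis by (rule DERIV_cong_ev[OF refl _ refl, THEN iffD1, rotated])
qed

lemma DERIV_V_inf:
  assumes "abar > 0" "0 < abar\<^sup>2 + \<beta> * s"
    and P: "(Pi_inf s abar has_real_derivative P) (at \<beta>)"
  shows "(V_inf s abar has_real_derivative - 2 * abar * P) (at \<beta>)"
proof -
  have "((\<lambda>b. s - 2 * abar * Pi_inf s abar b) has_real_derivative - 2 * abar * P) (at \<beta>)"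
    by (auto intro!: derivative_eq_intros P)
  moreover have "\<forall>\<^sub>F b in nhds \<beta>. s - 2 * abar * Pi_inf s abar b = V_inf s abar b"
    using eventually_rate_radicand_pos[OF assms(2)]
    by eventually_elim (simp add: V_inf_eq assms(1))
  ultimately show ?thesis by (rule DERIV_cong_ev[OF refl _ refl, THEN iffD1, rotated])
qed

section \<open>The cubic equation for the stationary rate\<close>

definition rate_cubic :: "real \<Rightarrow> real \<Rightarrow> real" where
  "rate_cubic abar r = 2 * r * (abar + r)\<^sup>2"

lemma rate_cubic_strict_mono:
  assumes "abar > 0" "0 \<le> r" "r < r'"
  shows "rate_cubic abar r < rate_cubic abar r'"
proof -
  have "(abar + r)\<^sup>2 < (abar + r')\<^sup>2"
    using assms by (intro power_strict_mono) auto
  then show ?thesis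
    unfolding rate_cubic_def using assms by (auto intro: mult_strict_mono)
qed

text \<open>The inverse is taken on the positive half-line, where the cubic is strictly increasing and onto;
\<open>abar\<close> is then an inner point of the domain, which keeps boundary cases out of the calculus.\<close>

definition rate_cubic_inv :: "real \<Rightarrow> real \<Rightarrow> real" where
  "rate_cubic_inv abar y = (THE r. 0 < r \<and> rate_cubic abar r = y)"

lemma rate_cubic_inv_unique:
  assumes "abar > 0" "0 < r"
  shows "rate_cubic_inv abar (rate_cubic abar r) = r"
  unfolding rate_cubic_inv_def
proof (rule the_equality)
  fix q assume "0 < q \<and> rate_cubic abar q = rate_cubic abar r"
  then show "q = r"
    using rate_cubic_strict_mono[of abar q r] rate_cubic_strict_mono[of abar r q] assms
    by (cases q r rule: linorder_cases) auto
qed (use assms in auto)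

lemma rate_cubic_inv:
  assumes "abar > 0" "0 < y"
  shows "0 < rate_cubic_inv abar y" "rate_cubic abar (rate_cubic_inv abar y) = y"
proof -
  have "\<exists>r. 0 \<le> r \<and> r \<le> y / (2 * abar\<^sup>2) \<and> rate_cubic abar r = y"
  proof (rule IVT')
    \<comment> \<open>\<open>2 * r * (abar + r)\<^sup>2 \<ge> 2 * r * abar\<^sup>2\<close> gives the upper end of the bracket.\<close>
    have "y = 2 * (y / (2 * abar\<^sup>2)) * abar\<^sup>2" using assms by simp
    also have "\<dots> \<le> rate_cubic abar (y / (2 * abar\<^sup>2))"
      unfolding rate_cubic_def using assms by (intro mult_left_mono power_mono) auto
    finally show "y \<le> rate_cubic abar (y / (2 * abar\<^sup>2))" .
    show "continuous_on {0..y / (2 * abar\<^sup>2)} (rate_cubic abar)"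
      unfolding rate_cubic_def by (intro continuous_intros)
  qed (use assms in \<open>auto simp: rate_cubic_def\<close>)
  then obtain r where r: "0 \<le> r" "rate_cubic abar r = y" by blast
  with assms have "0 < r" by (cases "r = 0") (auto simp: rate_cubic_def)
  then show "0 < rate_cubic_inv abar y" "rate_cubic abar (rate_cubic_inv abar y) = y"
    using rate_cubic_inv_unique[OF assms(1), of r] r by auto
qed

lemma rate_cubic_inv_mono:
  assumes "abar > 0" "0 < y" "y \<le> y'"
  shows "rate_cubic_inv abar y \<le> rate_cubic_inv abar y'"
  using rate_cubic_strict_mono[of abar "rate_cubic_inv abar y'" "rate_cubic_inv abar y"]
    rate_cubic_inv[of abar y] rate_cubic_inv[of abar y'] assms by force

lemma DERIV_rate_cubic_inv:
  assumes "abar > 0" "0 < y"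
  shows "\<exists>D>0. (rate_cubic_inv abar has_real_derivative D) (at y)"
proof -
  define r where "r = rate_cubic_inv abar y"
  have r: "r > 0" "rate_cubic abar r = y" using rate_cubic_inv[OF assms] by (auto simp: r_def)
  define E where "E = 2 * (abar + r)\<^sup>2 + 4 * r * (abar + r)"
  have E: "E > 0" using r assms by (auto simp: E_def intro!: add_pos_pos)
  have "(rate_cubic abar has_real_derivative E) (at r)"
    unfolding rate_cubic_def[abs_def] E_def
    by (auto intro!: derivative_eq_intros simp: algebra_simps)
  moreover have "isCont (rate_cubic_inv abar) y"
  proof -
    have "isCont (rate_cubic_inv abar) (rate_cubic abar r)"
    proof (rule isCont_inverse_function[where f = "rate_cubic abar" and x = r and d = "r / 2"])
      show "rate_cubic_inv abar (rate_cubic abar z) = z" if "\<bar>z - r\<bar> \<le> r / 2" for z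
        using that r by (intro rate_cubic_inv_unique[OF assms(1)]) linarith
      show "isCont (rate_cubic abar) z" for z
        unfolding rate_cubic_def[abs_def] by (intro continuous_intros)
    qed (use r in auto)
    then show ?thesis by (simp add: r)
  qed
  ultimately have "(rate_cubic_inv abar has_real_derivative inverse E) (at y)"
    using E assms rate_cubic_inv[OF assms(1)]
    by (intro DERIV_inverse_function[where f = "rate_cubic abar" and a = 0 and b = "y + 1"])
       (auto simp: r_def)
  then show ?thesis using E by (intro exI[of _ "inverse E"]) simp
qed

section \<open>The minimiser\<close>

text \<open>
Since the cubic takes the value \<open>8 * abar ^ 3\<close> at \<open>abar\<close>, truncating \<open>k > 0\<close> there amounts to
projecting the stationary rate onto the admissible range \<open>r \<ge> abar\<close>. For \<open>k \<le> 0\<close>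
the cost increases with the rate, and the truncation returns \<open>abar\<close> as well.
\<close>

definition opt_rate :: "real \<Rightarrow> real \<Rightarrow> real" where
  "opt_rate abar k = rate_cubic_inv abar (max k (8 * abar ^ 3))"

lemma rate_cubic_at_abar: "rate_cubic abar abar = 8 * abar ^ 3"
  by (simp add: rate_cubic_def power2_eq_square power3_eq_cube)

lemma opt_rate_ge:
  assumes "abar > 0" shows "abar \<le> opt_rate abar k"
  using rate_cubic_inv_mono[OF assms, of "rate_cubic abar abar" "max k (8 * abar ^ 3)"]
    rate_cubic_inv_unique[OF assms assms] assms
  by (simp add: opt_rate_def rate_cubic_at_abar)

lemma rate_cubic_opt_rate:
  assumes "abar > 0" shows "rate_cubic abar (opt_rate abar k) = max k (8 * abar ^ 3)"
  unfolding opt_rate_def by (rule rate_cubic_inv) (use assms in \<open>auto simp: less_max_iff_disj\<close>)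

lemma opt_rate_corner_iff:
  assumes "abar > 0" shows "opt_rate abar k = abar \<longleftrightarrow> k \<le> 8 * abar ^ 3"
  using rate_cubic_opt_rate[OF assms, of k] rate_cubic_inv_unique[OF assms assms]
  by (auto simp: opt_rate_def rate_cubic_at_abar max_def split: if_splits)

text \<open>The net price of belief variance relative to the price of disclosure, scaled so that the
first-order condition becomes \<open>rate_cubic abar r = cost_ratio s abar \<mu> L \<nu>\<close>.\<close>

definition cost_ratio :: "real \<Rightarrow> real \<Rightarrow> real \<Rightarrow> real \<Rightarrow> real \<Rightarrow> real" where
  "cost_ratio s abar \<mu> L \<nu> = (\<mu> - 2 * abar * \<nu>) * s\<^sup>2 / L"

text \<open>With \<open>q\<close> the optimal rate, the cost difference is \<open>(r - q) * (B - k)\<close> over a positive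
denominator, where \<open>B = (q + r) * (abar + r) * (abar + q)\<close> increases in \<open>r\<close> and reduces to the
cubic at \<open>r = q\<close>. Both factors thus have the same sign. This settles existence, uniqueness and the
corner at once, for \<open>k\<close> of either sign.\<close>

lemma rate_cost_less:
  assumes "abar > 0" "abar \<le> r" "r \<noteq> opt_rate abar k"
  shows "k / (abar + opt_rate abar k) + (opt_rate abar k)\<^sup>2 < k / (abar + r) + r\<^sup>2"
proof -
  define q where "q = opt_rate abar k"
  have q: "abar \<le> q" and cubic: "rate_cubic abar q = max k (8 * abar ^ 3)"
    using assms(1) opt_rate_ge rate_cubic_opt_rate by (auto simp: q_def)
  define B where "B = (q + r) * (abar + r) * (abar + q)"
  have factor: "k / (abar + r) + r\<^sup>2 - (k / (abar + q) + q\<^sup>2)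
      = (r - q) * (B - k) / ((abar + q) * (abar + r))"
    using assms q unfolding B_def by (simp add: divide_simps) (simp add: algebra_simps power2_eq_square)
  have "0 < (r - q) * (B - k)"
  proof (cases "q < r")
    case True
    have "rate_cubic abar q = (q + q) * (abar + q) * (abar + q)"
      by (simp add: rate_cubic_def power2_eq_square)
    also have "\<dots> < B"
      unfolding B_def using True assms(1) q by (intro mult_strict_right_mono mult_strict_mono) auto
    finally show ?thesis using cubic True by simp
  next
    case False
    with assms have "r < q" by (simp add: q_def)
    \<comment> \<open>An admissible rate below \<open>q\<close> rules out the corner, so the truncation is inactive.\<close>
    then have "k = rate_cubic abar q"
      using opt_rate_corner_iff[OF assms(1), of k] assms(2) cubic by (auto simp: q_def)
    also have "rate_cubic abar q = (q + q) * (abar + q) * (abar + q)"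
      by (simp add: rate_cubic_def power2_eq_square)
    also have "\<dots> > B"
      unfolding B_def using \<open>r < q\<close> assms(1,2) q by (intro mult_strict_right_mono mult_strict_mono) auto
    finally show ?thesis using \<open>r < q\<close> by (simp add: mult_neg_neg)
  qed
  then have "0 < (r - q) * (B - k) / ((abar + q) * (abar + r))"
    using assms q by simp
  then show ?thesis using factor by (simp add: q_def)
qed

lemma social_cost_rate:
  assumes "s > 0" "abar > 0" "L > 0" "0 \<le> \<beta>"
  defines "r \<equiv> closed_loop_rate s abar \<beta>"
  shows "social_cost s abar \<mu> L \<nu> \<beta> =
    L / s * (cost_ratio s abar \<mu> L \<nu> / (abar + r) + r\<^sup>2) + (\<nu> * s - L * abar\<^sup>2 / s)"
proof -
  have rad: "0 \<le> abar\<^sup>2 + \<beta> * s" using assms by simp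
  then have r: "0 \<le> r" "r\<^sup>2 = abar\<^sup>2 + \<beta> * s"
    by (auto simp: r_def closed_loop_rate_def)
  then have "L * \<beta> = L / s * r\<^sup>2 - L * abar\<^sup>2 / s"
    using assms by (simp add: field_simps)
  moreover have "(\<mu> - 2 * abar * \<nu>) * (s / (abar + r)) = L / s * (cost_ratio s abar \<mu> L \<nu> / (abar + r))"
    using assms(1,3) by (simp add: cost_ratio_def power2_eq_square)
  ultimately show ?thesis
    unfolding social_cost_eq[OF assms(2) rad] Pi_inf_eq[OF assms(2) rad] r_def[symmetric]
      distrib_left by linarith
qed

lemma social_cost_minimiser:
  fixes s abar \<mu> L \<nu> :: real
  assumes "s > 0" "abar > 0" "L > 0"
  defines "\<beta>0 \<equiv> ((opt_rate abar (cost_ratio s abar \<mu> L \<nu>))\<^sup>2 - abar\<^sup>2) / s"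
  shows "is_arg_min (social_cost s abar \<mu> L \<nu>) (\<lambda>b. 0 \<le> b) \<beta> \<longleftrightarrow> \<beta> = \<beta>0"
    and "opt_disclosure s abar \<mu> L \<nu> = \<beta>0"
proof -
  define k where "k = cost_ratio s abar \<mu> L \<nu>"
  define q where "q = opt_rate abar k"
  have q: "abar \<le> q" using assms opt_rate_ge by (simp add: q_def)
  have rate0: "closed_loop_rate s abar \<beta>0 = q"
    using assms(1,2) q by (simp add: closed_loop_rate_def \<beta>0_def q_def k_def)
  have \<beta>0: "0 \<le> \<beta>0"
    using assms(1,2) q by (simp add: \<beta>0_def q_def k_def)
  have less: "social_cost s abar \<mu> L \<nu> \<beta>0 < social_cost s abar \<mu> L \<nu> b"
    if "0 \<le> b" "b \<noteq> \<beta>0" for b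
  proof -
    define r where "r = closed_loop_rate s abar b"
    have "abar \<le> r"
      unfolding r_def closed_loop_rate_def using that assms(1) by (intro real_le_rsqrt) simp
    moreover have "r \<noteq> q"
    proof
      assume "r = q"
      moreover have "r\<^sup>2 = abar\<^sup>2 + b * s"
        using that assms(1) by (simp add: r_def closed_loop_rate_def)
      ultimately have "b = \<beta>0" using assms(1) by (simp add: \<beta>0_def q_def k_def)
      with that show False by simp
    qed
    ultimately have "k / (abar + q) + q\<^sup>2 < k / (abar + r) + r\<^sup>2"
      using rate_cost_less[OF assms(2)] by (simp add: q_def)
    then have "L / s * (k / (abar + q) + q\<^sup>2) < L / s * (k / (abar + r) + r\<^sup>2)"
      using assms(1,3) by (intro mult_strict_left_mono) auto
    then show ?thesis
      unfolding social_cost_rate[OF assms(1-3) that(1)] social_cost_rate[OF assms(1-3) \<beta>0]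
        rate0 k_def[symmetric] r_def[symmetric] by simp
  qed
  show iff: "is_arg_min (social_cost s abar \<mu> L \<nu>) (\<lambda>b. 0 \<le> b) \<beta> \<longleftrightarrow> \<beta> = \<beta>0" for \<beta>
    using less \<beta>0 unfolding is_arg_min_def by (metis order.asym)
  show "opt_disclosure s abar \<mu> L \<nu> = \<beta>0"
    unfolding opt_disclosure_def arg_min_def by (rule some_equality) (simp_all add: iff)
qed

section \<open>Marginal cost and the interior condition\<close>

lemma DERIV_social_cost:
  assumes P: "(Pi_inf s abar has_real_derivative P) (at \<beta>)"
    and V: "(V_inf s abar has_real_derivative V) (at \<beta>)"
  shows "(social_cost s abar \<mu> L \<nu> has_real_derivative \<mu> * P + \<nu> * V + L) (at \<beta>)"
  unfolding social_cost_def[abs_def] by (auto intro!: derivative_eq_intros P V)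

text \<open>The sign of the marginal cost is that of \<open>rate_cubic abar r - k\<close>: at \<open>\<beta> = 0\<close>, where
\<open>r = abar\<close>, this gives the sign of \<open>\<C>'(0)\<close>, and at the optimal rate it gives the first-order
condition.\<close>

lemma marginal_cost:
  assumes "s > 0" "abar > 0" "L > 0" "0 \<le> \<beta>"
  defines "r \<equiv> closed_loop_rate s abar \<beta>"
  obtains P V where "(Pi_inf s abar has_real_derivative P) (at \<beta>)"
    and "(V_inf s abar has_real_derivative V) (at \<beta>)"
    and "\<mu> * P + \<nu> * V + L = L * (rate_cubic abar r - cost_ratio s abar \<mu> L \<nu>) / rate_cubic abar r"
proof -
  have rad: "0 < abar\<^sup>2 + \<beta> * s" using assms by (intro add_pos_nonneg) auto
  then have "0 < r" by (simp add: r_def closed_loop_rate_def)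
  then have cubic: "0 < rate_cubic abar r" using assms by (simp add: rate_cubic_def)
  have P: "(Pi_inf s abar has_real_derivative - s\<^sup>2 / rate_cubic abar r) (at \<beta>)"
    using DERIV_Pi_inf[OF assms(2) rad] by (simp add: rate_cubic_def r_def)
  show ?thesis
  proof (rule that[OF P DERIV_V_inf[OF assms(2) rad P]])
    show "\<mu> * (- s\<^sup>2 / rate_cubic abar r) + \<nu> * (- 2 * abar * (- s\<^sup>2 / rate_cubic abar r)) + L
        = L * (rate_cubic abar r - cost_ratio s abar \<mu> L \<nu>) / rate_cubic abar r"
      using cubic assms(3) unfolding cost_ratio_def
      by (simp add: divide_simps) (simp add: algebra_simps)
  qed
qed

text \<open>
Both inequalities are \<open>8 * abar ^ 3 < k\<close> multiplied by a positive number; the link between them is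
\<open>v0 = 2 * abar * pi0\<close>, the first-order trace of the affine relation between \<open>\<V>\<close> and
\<open>\<Pi>\<close>.
\<close>

lemma interior_condition_iff:
  assumes "s > 0" "abar > 0" "L > 0"
  shows "\<mu> * pi0 s abar > \<nu> * v0 s abar + L \<longleftrightarrow> 8 * abar ^ 3 < cost_ratio s abar \<mu> L \<nu>"
    and "\<mu> > 2 * abar * \<nu> + 8 * abar ^ 3 / s\<^sup>2 * L \<longleftrightarrow> 8 * abar ^ 3 < cost_ratio s abar \<mu> L \<nu>"
proof -
  have "\<mu> * pi0 s abar - (\<nu> * v0 s abar + L)
      = L / (8 * abar ^ 3) * (cost_ratio s abar \<mu> L \<nu> - 8 * abar ^ 3)"
  proof -
    have "v0 s abar = 2 * abar * pi0 s abar"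
      using assms(2) by (simp add: v0_def pi0_def power2_eq_square power3_eq_cube)
    moreover have "L / (8 * abar ^ 3) * cost_ratio s abar \<mu> L \<nu> = (\<mu> - 2 * abar * \<nu>) * pi0 s abar"
      using assms(3) by (simp add: cost_ratio_def pi0_def)
    moreover have "L / (8 * abar ^ 3) * (8 * abar ^ 3) = L" using assms(2) by simp
    ultimately show ?thesis by (simp add: algebra_simps)
  qed
  moreover have "0 < L / (8 * abar ^ 3)" using assms by simp
  ultimately show "\<mu> * pi0 s abar > \<nu> * v0 s abar + L \<longleftrightarrow> 8 * abar ^ 3 < cost_ratio s abar \<mu> L \<nu>"
    by (smt (verit) zero_less_mult_iff)
  have "\<mu> - (2 * abar * \<nu> + 8 * abar ^ 3 / s\<^sup>2 * L)
      = L / s\<^sup>2 * (cost_ratio s abar \<mu> L \<nu> - 8 * abar ^ 3)"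
    using assms unfolding cost_ratio_def
    by (simp add: divide_simps) (simp add: algebra_simps)
  moreover have "0 < L / s\<^sup>2" using assms by simp
  ultimately show "\<mu> > 2 * abar * \<nu> + 8 * abar ^ 3 / s\<^sup>2 * L \<longleftrightarrow> 8 * abar ^ 3 < cost_ratio s abar \<mu> L \<nu>"
    by (smt (verit) zero_less_mult_iff)
qed

text \<open>A nonnegative net price of variance makes \<open>\<nu> * s + L * \<beta>\<close> a lower bound of the cost.\<close>

lemma social_cost_at_top:
  assumes "s > 0" "abar > 0" "L > 0" "0 \<le> cost_ratio s abar \<mu> L \<nu>"
  shows "filterlim (social_cost s abar \<mu> L \<nu>) at_top at_top"
proof (rule filterlim_at_top_mono)
  show "filterlim (\<lambda>\<beta>. \<nu> * s + L * \<beta>) at_top at_top"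
    using assms(3)
    by (intro filterlim_tendsto_add_at_top[OF tendsto_const]
        filterlim_tendsto_pos_mult_at_top[OF tendsto_const]) (auto intro: filterlim_ident)
  have gain: "0 \<le> \<mu> - 2 * abar * \<nu>"
    using assms by (simp add: cost_ratio_def zero_le_divide_iff zero_le_mult_iff)
  show "\<forall>\<^sub>F \<beta> in at_top. \<nu> * s + L * \<beta> \<le> social_cost s abar \<mu> L \<nu> \<beta>"
    using eventually_ge_at_top[of 0]
    by eventually_elim
       (use gain assms(1,2) in \<open>simp add: social_cost_eq Pi_inf_eq closed_loop_rate_def\<close>)
qed

section \<open>Dependence of the optimum on the congestion sensitivity\<close>

text \<open>
The strict inequality is an open condition on \<open>\<nu>\<close>, so the truncation in \<open>opt_rate\<close> stays
inactive nearby and the optimum is locally a smooth function of \<open>k\<close>, hence of \<open>\<nu>\<close>.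
\<close>

lemma DERIV_opt_disclosure:
  assumes "s > 0" "abar > 0" "L > 0" "8 * abar ^ 3 < cost_ratio s abar \<mu> L \<nu>"
  shows "\<exists>D<0. (opt_disclosure s abar \<mu> L has_real_derivative D) (at \<nu>)"
proof -
  define K where "K = cost_ratio s abar \<mu> L"
  define q where "q = rate_cubic_inv abar (K \<nu>)"
  have "0 < 8 * abar ^ 3" using assms(2) by simp
  then have K: "0 < K \<nu>" using assms(4) unfolding K_def by (rule less_trans)
  have q: "0 < q" using rate_cubic_inv[OF assms(2) K] by (simp add: q_def)
  obtain E where E: "E > 0" "(rate_cubic_inv abar has_real_derivative E) (at (K \<nu>))"
    using DERIV_rate_cubic_inv[OF assms(2) K] by blast
  have DK: "(K has_real_derivative - (2 * abar * s\<^sup>2 / L)) (at \<nu>)"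
    unfolding K_def cost_ratio_def[abs_def] using assms(3)
    by (auto intro!: derivative_eq_intros simp: field_simps)
  define D where "D = 2 * q * (E * - (2 * abar * s\<^sup>2 / L)) / s"
  have "((\<lambda>n. ((rate_cubic_inv abar (K n))\<^sup>2 - abar\<^sup>2) / s) has_real_derivative D) (at \<nu>)"
    unfolding D_def q_def using assms(1)
    by (auto intro!: derivative_eq_intros DERIV_chain2[OF E(2) DK])
  moreover have "\<forall>\<^sub>F n in nhds \<nu>. ((rate_cubic_inv abar (K n))\<^sup>2 - abar\<^sup>2) / s = opt_disclosure s abar \<mu> L n"
  proof -
    have "open {n. 8 * abar ^ 3 < K n}"
      unfolding K_def cost_ratio_def using assms(3)
      by (intro open_Collect_less continuous_intros) auto
    then have "\<forall>\<^sub>F n in nhds \<nu>. 8 * abar ^ 3 < K n"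
      using assms(4) eventually_nhds_in_open[of "{n. 8 * abar ^ 3 < K n}" \<nu>] by (simp add: K_def)
    then show ?thesis
      by eventually_elim (simp add: social_cost_minimiser(2)[OF assms(1-3)] opt_rate_def K_def)
  qed
  ultimately have "(opt_disclosure s abar \<mu> L has_real_derivative D) (at \<nu>)"
    by (rule DERIV_cong_ev[OF refl _ refl, THEN iffD1, rotated])
  moreover have "0 < 2 * q * (E * (2 * abar * s\<^sup>2 / L)) / s"
    using q E(1) assms(1-3) by simp
  then have "D < 0" by (simp add: D_def)
  ultimately show ?thesis by blast
qed

lemma opt_disclosure_antimono:
  assumes "s > 0" "abar > 0" "L > 0" "\<nu> \<le> \<nu>'"
  shows "opt_disclosure s abar \<mu> L \<nu>' \<le> opt_disclosure s abar \<mu> L \<nu>"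
proof -
  let ?q = "\<lambda>n. opt_rate abar (cost_ratio s abar \<mu> L n)"
  have "cost_ratio s abar \<mu> L \<nu>' \<le> cost_ratio s abar \<mu> L \<nu>"
    unfolding cost_ratio_def using assms by (intro divide_right_mono mult_right_mono) auto
  moreover have "0 < 8 * abar ^ 3" using assms(2) by simp
  ultimately have "?q \<nu>' \<le> ?q \<nu>"
    unfolding opt_rate_def by (intro rate_cubic_inv_mono assms(2)) (auto simp: less_max_iff_disj)
  moreover have "0 \<le> ?q \<nu>'" using opt_rate_ge[OF assms(2)] assms(2) by (meson less_imp_le order_trans)
  ultimately have "(?q \<nu>')\<^sup>2 \<le> (?q \<nu>)\<^sup>2" by (intro power_mono)
  then show ?thesis
    using assms(1) by (simp add: social_cost_minimiser(2)[OF assms(1-3)] divide_right_mono)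
qed

lemma opt_disclosure_eq_0_iff:
  assumes "s > 0" "abar > 0" "L > 0"
  shows "opt_disclosure s abar \<mu> L \<nu> = 0 \<longleftrightarrow> cost_ratio s abar \<mu> L \<nu> \<le> 8 * abar ^ 3"
proof -
  have "(opt_rate abar k)\<^sup>2 = abar\<^sup>2 \<longleftrightarrow> opt_rate abar k = abar" for k
    using opt_rate_ge[OF assms(2), of k] assms(2) by (intro power2_eq_iff_nonneg) auto
  then show ?thesis
    using assms by (simp add: social_cost_minimiser(2) opt_rate_corner_iff)
qed

text \<open>Once \<open>\<nu> \<ge> \<mu> / (2 * abar)\<close>, the net price of variance is nonpositive and the optimum has
already reached the corner.\<close>

lemma opt_disclosure_tendsto_0:
  assumes "s > 0" "abar > 0" "L > 0"
  shows "(opt_disclosure s abar \<mu> L \<longlongrightarrow> 0) at_top"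
proof (rule tendsto_eventually)
  have "\<forall>\<^sub>F \<nu> in at_top. \<mu> / (2 * abar) \<le> \<nu>" by (rule eventually_ge_at_top)
  then show "\<forall>\<^sub>F \<nu> in at_top. opt_disclosure s abar \<mu> L \<nu> = 0"
  proof eventually_elim
    case (elim \<nu>)
    then have "\<mu> - 2 * abar * \<nu> \<le> 0" using assms(2) by (simp add: field_simps)
    then have "cost_ratio s abar \<mu> L \<nu> \<le> 0"
      using assms(3) unfolding cost_ratio_def
      by (intro divide_nonpos_pos mult_nonpos_nonneg) auto
    also have "0 \<le> 8 * abar ^ 3" using assms(2) by simp
    finally show ?case by (simp add: opt_disclosure_eq_0_iff assms)
  qed
qed

theorem proposition9:
  fixes s abar \<mu> \<nu> L :: real
    and net :: "'w \<Rightarrow> evac_network" and sens :: "'w \<Rightarrow> real"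
  assumes s: "s > 0" and abar: "abar > 0" and mu: "\<mu> > 0" and nu: "\<nu> > 0" and L: "L > 0"
  shows
    "(\<forall>\<beta>. is_arg_min (social_cost s abar \<mu> L \<nu>) (\<lambda>b. 0 \<le> b) \<beta>
            \<longleftrightarrow> \<beta> = opt_disclosure s abar \<mu> L \<nu>)
     \<and> (\<mu> * pi0 s abar > \<nu> * v0 s abar + L
          \<longleftrightarrow> \<mu> > 2 * abar * \<nu> + 8 * abar ^ 3 / s\<^sup>2 * L)
     \<and> (\<mu> * pi0 s abar > \<nu> * v0 s abar + L \<longrightarrow>
          (\<exists>D<0. (social_cost s abar \<mu> L \<nu> has_real_derivative D) (at 0 within {0..}))
          \<and> filterlim (social_cost s abar \<mu> L \<nu>) at_top at_top
          \<and> 0 < opt_disclosure s abar \<mu> L \<nu>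
          \<and> (\<exists>P' V'. (Pi_inf s abar has_real_derivative P') (at (opt_disclosure s abar \<mu> L \<nu>))
                 \<and> (V_inf s abar has_real_derivative V') (at (opt_disclosure s abar \<mu> L \<nu>))
                 \<and> \<mu> * P' + \<nu> * V' + L = 0))
     \<and> (\<mu> * pi0 s abar \<le> \<nu> * v0 s abar + L \<longrightarrow>
          (\<exists>D\<ge>0. (social_cost s abar \<mu> L \<nu> has_real_derivative D) (at 0 within {0..}))
          \<and> opt_disclosure s abar \<mu> L \<nu> = 0)
     \<and> (\<mu> * pi0 s abar > \<nu> * v0 s abar + L \<longrightarrow>
          (\<exists>D<0. (opt_disclosure s abar \<mu> L has_real_derivative D) (at \<nu>)))
     \<and> antimono_on {0<..} (opt_disclosure s abar \<mu> L)
     \<and> (opt_disclosure s abar \<mu> L \<longlongrightarrow> 0) at_top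
     \<and> ((\<forall>w. wf_network (net w))
        \<and> filterlim sens at_top (filtercomap (\<lambda>w. cascade_radius (net w)) (at_left 1))
        \<longrightarrow> ((\<lambda>w. opt_disclosure s abar \<mu> L (sens w)) \<longlongrightarrow> 0)
               (filtercomap (\<lambda>w. cascade_radius (net w)) (at_left 1)))"
proof -
  define k where "k = cost_ratio s abar \<mu> L \<nu>"
  note cond = interior_condition_iff[OF s abar L, of \<nu> \<mu>, folded k_def]
  have corner: "opt_disclosure s abar \<mu> L \<nu> = 0 \<longleftrightarrow> k \<le> 8 * abar ^ 3"
    unfolding k_def by (rule opt_disclosure_eq_0_iff[OF s abar L])
  have arg_min: "is_arg_min (social_cost s abar \<mu> L \<nu>) (\<lambda>b. 0 \<le> b) \<beta>
      \<longleftrightarrow> \<beta> = opt_disclosure s abar \<mu> L \<nu>" for \<beta>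
    using social_cost_minimiser[OF s abar L] by simp
  then have opt_nonneg: "0 \<le> opt_disclosure s abar \<mu> L \<nu>"
    by (auto simp: is_arg_min_def)
  have slope: "(social_cost s abar \<mu> L \<nu> has_real_derivative L * (8 * abar ^ 3 - k) / (8 * abar ^ 3))
      (at 0 within {0..})"
  proof -
    have rate: "closed_loop_rate s abar 0 = abar" using abar by (simp add: closed_loop_rate_def)
    obtain P V where PV: "(Pi_inf s abar has_real_derivative P) (at 0)"
      "(V_inf s abar has_real_derivative V) (at 0)"
      "\<mu> * P + \<nu> * V + L = L * (8 * abar ^ 3 - k) / (8 * abar ^ 3)"
      using marginal_cost[OF s abar L order.refl, of \<mu> \<nu>] unfolding rate rate_cubic_at_abar k_def
      by blast
    show ?thesis
      using DERIV_social_cost[OF PV(1,2), of \<mu> L \<nu>] PV(3)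
      by (auto intro: has_field_derivative_at_within)
  qed
  have foc: "\<exists>P' V'. (Pi_inf s abar has_real_derivative P') (at (opt_disclosure s abar \<mu> L \<nu>))
       \<and> (V_inf s abar has_real_derivative V') (at (opt_disclosure s abar \<mu> L \<nu>))
       \<and> \<mu> * P' + \<nu> * V' + L = 0" if "8 * abar ^ 3 < k"
  proof -
    have "abar\<^sup>2 + opt_disclosure s abar \<mu> L \<nu> * s = (opt_rate abar k)\<^sup>2"
      using s by (simp add: social_cost_minimiser(2)[OF s abar L] k_def)
    then have "closed_loop_rate s abar (opt_disclosure s abar \<mu> L \<nu>) = opt_rate abar k"
      using opt_rate_ge[OF abar, of k] abar by (simp add: closed_loop_rate_def)
    moreover have "rate_cubic abar (opt_rate abar k) = k"
      using that by (simp add: rate_cubic_opt_rate[OF abar])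
    ultimately show ?thesis
      using marginal_cost[OF s abar L opt_nonneg, of \<mu> \<nu>] by (metis k_def diff_self mult_zero_right div_0)
  qed
  have pos: "0 < 8 * abar ^ 3" using abar by simp
  have interior: "(\<exists>D<0. (social_cost s abar \<mu> L \<nu> has_real_derivative D) (at 0 within {0..}))
      \<and> filterlim (social_cost s abar \<mu> L \<nu>) at_top at_top
      \<and> 0 < opt_disclosure s abar \<mu> L \<nu>" if "8 * abar ^ 3 < k"
  proof (intro conjI)
    have "L * (8 * abar ^ 3 - k) / (8 * abar ^ 3) < 0"
      using that pos L by (intro divide_neg_pos mult_pos_neg) auto
    then show "\<exists>D<0. (social_cost s abar \<mu> L \<nu> has_real_derivative D) (at 0 within {0..})"
      using slope by blast
    show "filterlim (social_cost s abar \<mu> L \<nu>) at_top at_top"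
      using that pos unfolding k_def by (intro social_cost_at_top s abar L) linarith
    show "0 < opt_disclosure s abar \<mu> L \<nu>" using opt_nonneg corner that by linarith
  qed
  have corner_slope: "\<exists>D\<ge>0. (social_cost s abar \<mu> L \<nu> has_real_derivative D) (at 0 within {0..})"
    if "k \<le> 8 * abar ^ 3"
    using slope that pos L by (intro exI[of _ "L * (8 * abar ^ 3 - k) / (8 * abar ^ 3)"]) simp
  have "antimono_on {0<..} (opt_disclosure s abar \<mu> L)"
    by (auto simp: monotone_on_def intro: opt_disclosure_antimono[OF s abar L])
  moreover have "((\<lambda>w. opt_disclosure s abar \<mu> L (sens w)) \<longlongrightarrow> 0) F"
    if "filterlim sens at_top F" for F
    using opt_disclosure_tendsto_0[OF s abar L] that by (rule filterlim_compose)
  ultimately show ?thesis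
    using arg_min cond interior foc corner corner_slope
      DERIV_opt_disclosure[OF s abar L, of \<mu> \<nu>] opt_disclosure_tendsto_0[OF s abar L]
    unfolding k_def[symmetric] not_less[symmetric] by blast
qed

end
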